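(* Let $G$ be a finite group and let $X$ be a real algebraic $G$-variety of dimension $d$. For all $r\ge 2$ and $p,q\in\mathbb{Z}$, if ${}^G\!\widetilde{E}^r_{p,q}(X)\neq 0$ then $0\le q\le d$ and $p+q\le d$.
   Context: **Varieties and chains.** A real algebraic variety is a reduced separated scheme of finite type over $\mathbb{R}$; a real algebraic $G$-variety carries an action of $G$ by scheme isomorphisms such that every orbit lies in an affine open subscheme. $C_*(X)$ is the complex of semialgebraic chains with closed supports and $\mathbb{Z}_2$-coefficients of the real points $X_{\mathbb{R}}$: $C_k(X)$ is generated by closed semialgebraic subsets of $X_{\mathbb{R}}$ of dimension $\le k$ modulo $A+B\sim\overline{A\div B}$ and $A\sim0$ if $\dim A<k$, with the semialgebraic boundary. $G$ acts on it by functoriality. **Weight complex with action.** $\mathcal{W}C_*(X)$ is the weight complex with action of $X$: a bounded complex of $\mathbb{Z}_2$-vector spaces with $G$-action and bounded increasing $G$-stable filtration, well-defined up to equivariant filtered quasi-isomorphism (equivariant filtered morphisms inducing isomorphisms on $E^1$). It is represented by the Nash-constructible filtration $\mathcal{N}C_*(X)$ (with the induced $G$-action), which may be taken as its definition: for $-k\le p\le 0$, $c\in\mathcal{N}_pC_k(X)$ iff there is a function $\varphi:X_{\mathbb{R}}\to 2^{k+p}\mathbb{Z}$ which coincides with a Nash-constructible function outside a semialgebraic subset of dimension $<k$ and such that $c=[\{x:\varphi(x)\notin 2^{k+p+1}\mathbb{Z}\}]$ up to a set of dimension $<k$; $\mathcal{N}_pC_k=0$ for $p<-k$ and $\mathcal{N}_pC_k=C_k$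 for $p\ge0$. Here a function on the real points of a complete variety $\overline X$ is Nash-constructible if it is of the form $x\mapsto\sum_i m_i\,\chi(f_i^{-1}(x)\cap Z_i')$ (finite sum, $m_i\in\mathbb{Z}$, $f_i:Z_i\to\overline X$ proper regular, $Z_i'$ a connected component of the real points of $Z_i$), and on a general $X$ it is the restriction of such a function on a compactification $\overline X$. **Equivariant weight spectral sequence.** Fix a projective resolution $F_*$ of $\mathbb{Z}$ over $\mathbb{Z}[G]$. For a bounded $G$-complex $K_*$ of $\mathbb{Z}_2$-vector spaces, $L_*(K_* )$ is the total complex of $(\mathrm{Hom}_G(F_{-p},K_q))_{p,q}$; if $K_*$ is filtered by $J$, then $L_*(K_* )$ is filtered by $\mathcal{J}_\alpha L_k(K_* )=L_k(J_\alpha K_* )$. The equivariant weight complex is $\Omega C^G_*(X)=L_*(\mathcal{W}C_*(X))$. Let ${}^G\!E^r_{p,q}$ be the spectral sequence of this filtered complex (with ${}^G\!E^0_{p,q}$ the degree $p+q$ part of the $p$-th graded piece). It is reindexed by $p'=2p+q$, $q'=-p$, $r'=r+1$, giving the equivariant weight spectral sequence ${}^G\!\widetilde{E}^{r'}_{p',q'}(X)$. *)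

theory Defs
  imports
    "HOL-Algebra.Generated_Rings"
    "HOL-Algebra.Ideal"
    "HOL-Homology.Homology"
    "HOL-Library.Extended_Real"
begin

section \<open>Schemes over the real numbers\<close>

definition real_ring :: "real ring" where
  "real_ring = \<lparr>carrier = UNIV, monoid.mult = (*), one = 1, ring.zero = 0, ring.add = (+)\<rparr>"

text \<open>The field \<open>zar\<close> is the Zariski topology, \<open>sect\<close> and \<open>res\<close> the structure sheaf
  (meaningful on open sets only), and \<open>struc\<close> the homomorphism from \<open>\<real>\<close> to the global sections
  which corresponds to the structure morphism to \<open>Spec \<real>\<close>.\<close>

record ('p, 's) rscheme =
  zar :: "'p topology"
  sect :: "'p set \<Rightarrow> 's ring"
  res :: "'p set \<Rightarrow> 'p set \<Rightarrow> 's \<Rightarrow> 's"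
  struc :: "real \<Rightarrow> 's"

abbreviation pts :: "('p, 's) rscheme \<Rightarrow> 'p set" where
  "pts X \<equiv> topspace (zar X)"

definition presheaf_of_rings :: "('p, 's) rscheme \<Rightarrow> bool" where
  "presheaf_of_rings X \<longleftrightarrow>
     (\<forall>U. openin (zar X) U \<longrightarrow> cring (sect X U)) \<and>
     (\<forall>U V. openin (zar X) U \<and> openin (zar X) V \<and> V \<subseteq> U \<longrightarrow>
        res X U V \<in> ring_hom (sect X U) (sect X V)) \<and>
     (\<forall>U. openin (zar X) U \<longrightarrow> (\<forall>s\<in>carrier (sect X U). res X U U s = s)) \<and>
     (\<forall>U V W. openin (zar X) U \<and> openin (zar X) V \<and> openin (zar X) W \<and> W \<subseteq> V \<and> V \<subseteq> U \<longrightarrow>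
        (\<forall>s\<in>carrier (sect X U). res X V W (res X U V s) = res X U W s))"

definition sheaf_of_rings :: "('p, 's) rscheme \<Rightarrow> bool" where
  "sheaf_of_rings X \<longleftrightarrow> presheaf_of_rings X \<and>
     (\<forall>\<U> \<sigma>. (\<forall>U\<in>\<U>. openin (zar X) U \<and> \<sigma> U \<in> carrier (sect X U)) \<and>
        (\<forall>U\<in>\<U>. \<forall>V\<in>\<U>. res X U (U \<inter> V) (\<sigma> U) = res X V (U \<inter> V) (\<sigma> V)) \<longrightarrow>
        (\<exists>!s. s \<in> carrier (sect X (\<Union>\<U>)) \<and> (\<forall>U\<in>\<U>. res X (\<Union>\<U>) U s = \<sigma> U)))"

text \<open>The germ at \<open>x\<close> of a section over \<open>U\<close> is a non-unit of the stalk, that is (for a local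
  stalk), it lies in the maximal ideal.\<close>

definition vanishes_at :: "('p, 's) rscheme \<Rightarrow> 'p set \<Rightarrow> 's \<Rightarrow> 'p \<Rightarrow> bool" where
  "vanishes_at X U s x \<longleftrightarrow>
     \<not> (\<exists>V. openin (zar X) V \<and> x \<in> V \<and> V \<subseteq> U \<and> res X U V s \<in> Units (sect X V))"

text \<open>Every stalk is a local ring: it is nonzero and its non-units are closed under addition.\<close>

definition local_stalks :: "('p, 's) rscheme \<Rightarrow> bool" where
  "local_stalks X \<longleftrightarrow> (\<forall>U x. openin (zar X) U \<and> x \<in> U \<longrightarrow>
     vanishes_at X U \<zero>\<^bsub>sect X U\<^esub> x \<and>
     (\<forall>s\<in>carrier (sect X U). \<forall>t\<in>carrier (sect X U).
        vanishes_at X U s x \<and> vanishes_at X U t x \<longrightarrow> vanishes_at X U (s \<oplus>\<^bsub>sect X U\<^esub> t) x))"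

definition Spec_top :: "'s ring \<Rightarrow> 's set topology" where
  "Spec_top R = topology_generated_by ((\<lambda>f. {P. primeideal P R \<and> f \<notin> P}) ` carrier R)"

definition is_localization :: "'s ring \<Rightarrow> 's \<Rightarrow> 't ring \<Rightarrow> ('s \<Rightarrow> 't) \<Rightarrow> bool" where
  "is_localization R f R' \<phi> \<longleftrightarrow> \<phi> \<in> ring_hom R R' \<and> \<phi> f \<in> Units R' \<and>
     (\<forall>t\<in>carrier R'. \<exists>s\<in>carrier R. \<exists>n::nat. \<phi> f [^]\<^bsub>R'\<^esub> n \<otimes>\<^bsub>R'\<^esub> t = \<phi> s) \<and>
     (\<forall>s\<in>carrier R. \<phi> s = \<zero>\<^bsub>R'\<^esub> \<longrightarrow> (\<exists>n::nat. f [^]\<^bsub>R\<^esub> n \<otimes>\<^bsub>R\<^esub> s = \<zero>\<^bsub>R\<^esub>))"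

text \<open>The open subset \<open>U\<close> with the restricted sheaf is the spectrum of its ring of sections:
  the canonical map to the prime spectrum is a homeomorphism and the sheaf is given on the basic
  open sets \<open>D(f)\<close> by the localizations \<open>R\<^sub>f\<close>.\<close>

definition affine_open :: "('p, 's) rscheme \<Rightarrow> 'p set \<Rightarrow> bool" where
  "affine_open X U \<longleftrightarrow> openin (zar X) U \<and>
     homeomorphic_map (subtopology (zar X) U) (Spec_top (sect X U))
       (\<lambda>x. {s \<in> carrier (sect X U). vanishes_at X U s x}) \<and>
     (\<forall>f\<in>carrier (sect X U).
        is_localization (sect X U) f (sect X {x \<in> U. \<not> vanishes_at X U f x})
          (res X U {x \<in> U. \<not> vanishes_at X U f x}))"

definition is_rscheme :: "('p, 's) rscheme \<Rightarrow> bool" where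
  "is_rscheme X \<longleftrightarrow> sheaf_of_rings X \<and> local_stalks X \<and>
     struc X \<in> ring_hom real_ring (sect X (pts X)) \<and>
     (\<forall>x\<in>pts X. \<exists>U. affine_open X U \<and> x \<in> U)"

definition const_sect :: "('p, 's) rscheme \<Rightarrow> 'p set \<Rightarrow> real \<Rightarrow> 's" where
  "const_sect X U c = res X (pts X) U (struc X c)"

definition alg_generators :: "('p, 's) rscheme \<Rightarrow> 'p set \<Rightarrow> 's set \<Rightarrow> bool" where
  "alg_generators X U S \<longleftrightarrow> finite S \<and> S \<subseteq> carrier (sect X U) \<and>
     generate_ring (sect X U) (range (const_sect X U) \<union> S) = carrier (sect X U)"

definition finite_type :: "('p, 's) rscheme \<Rightarrow> bool" where
  "finite_type X \<longleftrightarrow> is_rscheme X \<and>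
     (\<exists>\<U>. finite \<U> \<and> \<Union>\<U> = pts X \<and> (\<forall>U\<in>\<U>. affine_open X U \<and> (\<exists>S. alg_generators X U S)))"

definition reduced :: "('p, 's) rscheme \<Rightarrow> bool" where
  "reduced X \<longleftrightarrow> (\<forall>U. openin (zar X) U \<longrightarrow> (\<forall>s\<in>carrier (sect X U). \<forall>n::nat.
     s [^]\<^bsub>sect X U\<^esub> n = \<zero>\<^bsub>sect X U\<^esub> \<longrightarrow> s = \<zero>\<^bsub>sect X U\<^esub>))"

subsection \<open>Morphisms\<close>

text \<open>A morphism from \<open>X\<close> to \<open>Y\<close> is a map \<open>pmap\<close> on points with a comorphism \<open>cmap V\<close> from the
  sections over \<open>V\<close> to those over the preimage of \<open>V\<close>, for each open \<open>V\<close>. Values outside the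
  carriers are irrelevant, hence the equality \<open>mor_eq\<close>.\<close>

record ('p, 's, 'q, 't) mor =
  pmap :: "'p \<Rightarrow> 'q"
  cmap :: "'q set \<Rightarrow> 't \<Rightarrow> 's"

definition preim :: "('p, 's) rscheme \<Rightarrow> ('p, 's, 'q, 't) mor \<Rightarrow> 'q set \<Rightarrow> 'p set" where
  "preim X f V = {x \<in> pts X. pmap f x \<in> V}"

definition is_mor :: "('p, 's) rscheme \<Rightarrow> ('q, 't) rscheme \<Rightarrow> ('p, 's, 'q, 't) mor \<Rightarrow> bool" where
  "is_mor X Y f \<longleftrightarrow> continuous_map (zar X) (zar Y) (pmap f) \<and>
     (\<forall>V. openin (zar Y) V \<longrightarrow> cmap f V \<in> ring_hom (sect Y V) (sect X (preim X f V))) \<and>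
     (\<forall>V W. openin (zar Y) V \<and> openin (zar Y) W \<and> W \<subseteq> V \<longrightarrow> (\<forall>t\<in>carrier (sect Y V).
        res X (preim X f V) (preim X f W) (cmap f V t) = cmap f W (res Y V W t))) \<and>
     (\<forall>V x. openin (zar Y) V \<and> x \<in> preim X f V \<longrightarrow> (\<forall>t\<in>carrier (sect Y V).
        vanishes_at Y V t (pmap f x) \<longrightarrow> vanishes_at X (preim X f V) (cmap f V t) x)) \<and>
     (\<forall>c. cmap f (pts Y) (struc Y c) = struc X c)"

definition mor_eq ::
    "('p, 's) rscheme \<Rightarrow> ('q, 't) rscheme \<Rightarrow> ('p, 's, 'q, 't) mor \<Rightarrow> ('p, 's, 'q, 't) mor \<Rightarrow> bool" where
  "mor_eq X Y f g \<longleftrightarrow> (\<forall>x\<in>pts X. pmap f x = pmap g x) \<and>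
     (\<forall>V. openin (zar Y) V \<longrightarrow> (\<forall>t\<in>carrier (sect Y V). cmap f V t = cmap g V t))"

definition id_mor :: "('p, 's, 'p, 's) mor" where
  "id_mor = \<lparr>pmap = id, cmap = (\<lambda>V. id)\<rparr>"

definition mor_comp ::
    "('q, 't) rscheme \<Rightarrow> ('q, 't, 'r, 'u) mor \<Rightarrow> ('p, 's, 'q, 't) mor \<Rightarrow> ('p, 's, 'r, 'u) mor" where
  "mor_comp Y g f = \<lparr>pmap = pmap g \<circ> pmap f, cmap = (\<lambda>W. cmap f (preim Y g W) \<circ> cmap g W)\<rparr>"

definition open_immersion ::
    "('p, 's) rscheme \<Rightarrow> ('q, 't) rscheme \<Rightarrow> ('p, 's, 'q, 't) mor \<Rightarrow> bool" where
  "open_immersion X Y f \<longleftrightarrow> is_mor X Y f \<and>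
     embedding_map (zar X) (zar Y) (pmap f) \<and> open_map (zar X) (zar Y) (pmap f) \<and>
     (\<forall>V. openin (zar Y) V \<and> V \<subseteq> pmap f ` pts X \<longrightarrow>
        bij_betw (cmap f V) (carrier (sect Y V)) (carrier (sect X (preim X f V))))"

text \<open>The last condition is the surjectivity of the comorphism on stalks.\<close>

definition closed_immersion ::
    "('p, 's) rscheme \<Rightarrow> ('q, 't) rscheme \<Rightarrow> ('p, 's, 'q, 't) mor \<Rightarrow> bool" where
  "closed_immersion X Y f \<longleftrightarrow> is_mor X Y f \<and>
     embedding_map (zar X) (zar Y) (pmap f) \<and> closed_map (zar X) (zar Y) (pmap f) \<and>
     (\<forall>U x s. openin (zar X) U \<and> x \<in> U \<and> s \<in> carrier (sect X U) \<longrightarrow>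
        (\<exists>W t V. openin (zar Y) W \<and> t \<in> carrier (sect Y W) \<and>
           openin (zar X) V \<and> x \<in> V \<and> V \<subseteq> U \<and> V \<subseteq> preim X f W \<and>
           res X (preim X f W) V (cmap f W t) = res X U V s))"

subsection \<open>Fibre products, separated and proper morphisms\<close>

text \<open>A definition cannot quantify over types, so auxiliary schemes are taken with points and
  sections in the type \<open>real\<close>. This loses nothing: a scheme of finite type over \<open>\<real>\<close> has at most
  continuum many points and at most continuum many sections over each open set, so it is isomorphic
  to one of this kind. Fibre products are formed in the category of schemes of finite type over
  \<open>\<real>\<close>; they are the fibre products in the category of all schemes.\<close>

type_synonym std_rscheme = "(real, real) rscheme"

definition fibre_product ::
    "('p, 's) rscheme \<Rightarrow> ('q, 't) rscheme \<Rightarrow> ('r, 'u) rscheme \<Rightarrow>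
     ('p, 's, 'r, 'u) mor \<Rightarrow> ('q, 't, 'r, 'u) mor \<Rightarrow>
     std_rscheme \<Rightarrow> (real, real, 'p, 's) mor \<Rightarrow> (real, real, 'q, 't) mor \<Rightarrow> bool" where
  "fibre_product X Y B f g P \<pi>\<^sub>1 \<pi>\<^sub>2 \<longleftrightarrow>
     finite_type P \<and> is_mor P X \<pi>\<^sub>1 \<and> is_mor P Y \<pi>\<^sub>2 \<and>
     mor_eq P B (mor_comp X f \<pi>\<^sub>1) (mor_comp Y g \<pi>\<^sub>2) \<and>
     (\<forall>(T::std_rscheme) a b. finite_type T \<and> is_mor T X a \<and> is_mor T Y b \<and>
        mor_eq T B (mor_comp X f a) (mor_comp Y g b) \<longrightarrow>
        (\<exists>u. is_mor T P u \<and> mor_eq T X (mor_comp P \<pi>\<^sub>1 u) a \<and> mor_eq T Y (mor_comp P \<pi>\<^sub>2 u) b \<and>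
           (\<forall>v. is_mor T P v \<and> mor_eq T X (mor_comp P \<pi>\<^sub>1 v) a \<and> mor_eq T Y (mor_comp P \<pi>\<^sub>2 v) b \<longrightarrow>
              mor_eq T P v u)))"

text \<open>The diagonal \<open>\<delta>\<close> of \<open>X\<close> over \<open>B\<close> is a closed immersion.\<close>

definition separated_mor ::
    "('p, 's) rscheme \<Rightarrow> ('r, 'u) rscheme \<Rightarrow> ('p, 's, 'r, 'u) mor \<Rightarrow> bool" where
  "separated_mor X B f \<longleftrightarrow> (\<exists>P \<pi>\<^sub>1 \<pi>\<^sub>2 \<delta>. fibre_product X X B f f P \<pi>\<^sub>1 \<pi>\<^sub>2 \<and>
     is_mor X P \<delta> \<and> mor_eq X X (mor_comp P \<pi>\<^sub>1 \<delta>) id_mor \<and> mor_eq X X (mor_comp P \<pi>\<^sub>2 \<delta>) id_mor \<and>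
     closed_immersion X P \<delta>)"

text \<open>Properness of a morphism between schemes of finite type over \<open>\<real>\<close>. Such a morphism is
  automatically of finite type, and universal closedness may be tested on base changes of finite
  type.\<close>

definition proper_mor ::
    "('p, 's) rscheme \<Rightarrow> ('r, 'u) rscheme \<Rightarrow> ('p, 's, 'r, 'u) mor \<Rightarrow> bool" where
  "proper_mor X B f \<longleftrightarrow> is_mor X B f \<and> separated_mor X B f \<and>
     (\<forall>(T::std_rscheme) h P \<pi>\<^sub>1 \<pi>\<^sub>2. finite_type T \<and> is_mor T B h \<and>
        fibre_product X T B f h P \<pi>\<^sub>1 \<pi>\<^sub>2 \<longrightarrow> closed_map (zar P) (zar T) (pmap \<pi>\<^sub>2))"

definition Spec_real :: std_rscheme where
  "Spec_real = \<lparr>zar = discrete_topology {0},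
     sect = (\<lambda>U. if U = {} then real_ring\<lparr>carrier := {0}, one := 0\<rparr> else real_ring),
     res = (\<lambda>U V c. if V = {} then 0 else c),
     struc = id\<rparr>"

definition structure_mor :: "('p, 's) rscheme \<Rightarrow> ('p, 's, real, real) mor" where
  "structure_mor X = \<lparr>pmap = (\<lambda>x. 0), cmap = (\<lambda>V c. const_sect X {x \<in> pts X. 0 \<in> V} c)\<rparr>"

definition real_variety :: "('p, 's) rscheme \<Rightarrow> bool" where
  "real_variety X \<longleftrightarrow> finite_type X \<and> reduced X \<and> separated_mor X Spec_real (structure_mor X)"

definition complete_variety :: "('p, 's) rscheme \<Rightarrow> bool" where
  "complete_variety X \<longleftrightarrow> real_variety X \<and> proper_mor X Spec_real (structure_mor X)"

text \<open>Only morphisms are required here, since \<open>\<rho> g\<close> has the inverse \<open>\<rho> (g\<^sup>-\<^sup>1)\<close>.\<close>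

definition real_G_variety ::
    "('g, 'm) monoid_scheme \<Rightarrow> ('p, 's) rscheme \<Rightarrow> ('g \<Rightarrow> ('p, 's, 'p, 's) mor) \<Rightarrow> bool" where
  "real_G_variety G X \<rho> \<longleftrightarrow> real_variety X \<and>
     (\<forall>g\<in>carrier G. is_mor X X (\<rho> g)) \<and>
     mor_eq X X (\<rho> \<one>\<^bsub>G\<^esub>) id_mor \<and>
     (\<forall>g\<in>carrier G. \<forall>h\<in>carrier G. mor_eq X X (\<rho> (g \<otimes>\<^bsub>G\<^esub> h)) (mor_comp X (\<rho> g) (\<rho> h))) \<and>
     (\<forall>x\<in>pts X. \<exists>U. affine_open X U \<and> (\<forall>g\<in>carrier G. pmap (\<rho> g) x \<in> U))"

subsection \<open>Dimension\<close>

definition irreducible_closed :: "'p topology \<Rightarrow> 'p set \<Rightarrow> bool" where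
  "irreducible_closed T Z \<longleftrightarrow> closedin T Z \<and> Z \<noteq> {} \<and>
     (\<forall>A B. closedin T A \<and> closedin T B \<and> Z = A \<union> B \<longrightarrow> Z = A \<or> Z = B)"

text \<open>The empty space has dimension \<open>-\<infinity>\<close>.\<close>

definition krull_dim :: "'p topology \<Rightarrow> ereal" where
  "krull_dim T = Sup {ereal (real n) | n. \<exists>Z::nat \<Rightarrow> 'p set.
     (\<forall>i\<le>n. irreducible_closed T (Z i)) \<and> (\<forall>i<n. Z i \<subset> Z (Suc i))}"

section \<open>Real points and semialgebraic sets\<close>

text \<open>The points with residue field \<open>\<real>\<close>.\<close>

definition real_pts :: "('p, 's) rscheme \<Rightarrow> 'p set" where
  "real_pts X = {x \<in> pts X. \<forall>U. openin (zar X) U \<and> x \<in> U \<longrightarrow>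
     (\<forall>s\<in>carrier (sect X U). \<exists>c. vanishes_at X U (s \<ominus>\<^bsub>sect X U\<^esub> const_sect X U c) x)}"

definition val :: "('p, 's) rscheme \<Rightarrow> 'p set \<Rightarrow> 's \<Rightarrow> 'p \<Rightarrow> real" where
  "val X U s x = (THE c. vanishes_at X U (s \<ominus>\<^bsub>sect X U\<^esub> const_sect X U c) x)"

text \<open>The Euclidean topology on the real points.\<close>

definition euclid :: "('p, 's) rscheme \<Rightarrow> 'p topology" where
  "euclid X = topology_generated_by
     {{x \<in> real_pts X \<inter> U. val X U f x > 0} | U f. affine_open X U \<and> f \<in> carrier (sect X U)}"

inductive_set semialg_affine :: "('p, 's) rscheme \<Rightarrow> 'p set \<Rightarrow> 'p set set" for X U where
  pos: "f \<in> carrier (sect X U) \<Longrightarrow> {x \<in> real_pts X \<inter> U. val X U f x > 0} \<in> semialg_affine X U"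
| compl: "A \<in> semialg_affine X U \<Longrightarrow> (real_pts X \<inter> U) - A \<in> semialg_affine X U"
| un: "A \<in> semialg_affine X U \<Longrightarrow> B \<in> semialg_affine X U \<Longrightarrow> A \<union> B \<in> semialg_affine X U"

definition semialg :: "('p, 's) rscheme \<Rightarrow> 'p set \<Rightarrow> bool" where
  "semialg X A \<longleftrightarrow> A \<subseteq> real_pts X \<and> (\<forall>U. affine_open X U \<longrightarrow> A \<inter> U \<in> semialg_affine X U)"

text \<open>The dimension of a semialgebraic set is the Krull dimension of its Zariski closure.\<close>

definition semialg_dim :: "('p, 's) rscheme \<Rightarrow> 'p set \<Rightarrow> ereal" where
  "semialg_dim X A = krull_dim (subtopology (zar X) (zar X closure_of A))"

definition small :: "('p, 's) rscheme \<Rightarrow> int \<Rightarrow> 'p set \<Rightarrow> bool" where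
  "small X k A \<longleftrightarrow> semialg X A \<and> semialg_dim X A < ereal (of_int k)"

section \<open>The Euler characteristic\<close>

definition independent_in :: "'a monoid \<Rightarrow> 'a set \<Rightarrow> bool" where
  "independent_in H S \<longleftrightarrow> finite S \<and> S \<subseteq> carrier H \<and>
     (\<forall>c::'a \<Rightarrow> int. finprod H (\<lambda>s. s [^]\<^bsub>H\<^esub> c s) S = \<one>\<^bsub>H\<^esub> \<longrightarrow> (\<forall>s\<in>S. c s = 0))"

definition ab_rank :: "'a monoid \<Rightarrow> nat" where
  "ab_rank H = Sup (card ` {S. independent_in H S})"

text \<open>Only applied to compact semialgebraic sets, whose integral homology is finitely
  generated.\<close>

definition euler_char :: "'p topology \<Rightarrow> int" where
  "euler_char T = (\<Sum>i | ab_rank (homology_group (int i) T) \<noteq> 0.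
     (-1) ^ i * int (ab_rank (homology_group (int i) T)))"

section \<open>Semialgebraic chains with closed supports\<close>

definition chain_gens :: "('p, 's) rscheme \<Rightarrow> int \<Rightarrow> 'p set set" where
  "chain_gens X k =
     {A. semialg X A \<and> closedin (euclid X) A \<and> semialg_dim X A \<le> ereal (of_int k)}"

text \<open>The free \<open>\<int>\<^sub>2\<close>-vector space on a set: a formal sum is the finite set of its terms.\<close>

definition free_Z2 :: "'a set \<Rightarrow> 'a set monoid" where
  "free_Z2 S = \<lparr>carrier = {F. finite F \<and> F \<subseteq> S}, monoid.mult = (\<lambda>E F. sym_diff E F), one = {}\<rparr>"

text \<open>\<open>A + B + cl (A \<div> B)\<close> is written with the addition of \<open>free_Z2\<close>, since these three sets need not
  be distinct.\<close>

definition chain_rels :: "('p, 's) rscheme \<Rightarrow> int \<Rightarrow> 'p set set set" where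
  "chain_rels X k = generate (free_Z2 (chain_gens X k))
     ({sym_diff (sym_diff {A} {B}) {euclid X closure_of (sym_diff A B)} | A B.
          A \<in> chain_gens X k \<and> B \<in> chain_gens X k} \<union>
      {{A} | A. A \<in> chain_gens X k \<and> semialg_dim X A < ereal (of_int k)})"

definition sa_chains :: "('p, 's) rscheme \<Rightarrow> int \<Rightarrow> 'p set set set monoid" where
  "sa_chains X k = free_Z2 (chain_gens X k) Mod chain_rels X k"

definition chain_class :: "('p, 's) rscheme \<Rightarrow> int \<Rightarrow> 'p set \<Rightarrow> 'p set set set" where
  "chain_class X k A = chain_rels X k #>\<^bsub>free_Z2 (chain_gens X k)\<^esub> {A}"

text \<open>The linear map from \<open>k\<close>-chains to \<open>l\<close>-chains with \<open>[A] \<mapsto> [b A]\<close> for the generators \<open>A\<close>, where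
  \<open>b\<close> is compatible with the relations.\<close>

definition chain_map_of ::
    "('p, 's) rscheme \<Rightarrow> int \<Rightarrow> int \<Rightarrow> ('p set \<Rightarrow> 'p set) \<Rightarrow> 'p set set set \<Rightarrow> 'p set set set" where
  "chain_map_of X k l b c =
     the_elem ((\<lambda>F. finprod (sa_chains X l) (\<lambda>A. chain_class X l (b A)) F) ` c)"

text \<open>The intersection of \<open>A\<close> with a small sphere around \<open>x\<close>, in the embedding of the affine set
  \<open>U\<close> into an affine space given by the generators \<open>S\<close>.\<close>

definition sphere_link :: "('p, 's) rscheme \<Rightarrow> 'p set \<Rightarrow> 's set \<Rightarrow> 'p \<Rightarrow> real \<Rightarrow> 'p set \<Rightarrow> 'p set" where
  "sphere_link X U S x \<epsilon> A = {y \<in> A \<inter> U. (\<Sum>f\<in>S. (val X U f y - val X U f x)\<^sup>2) = \<epsilon>\<^sup>2}"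

text \<open>The semialgebraic boundary \<open>[A] \<mapsto> [\<partial>A]\<close> consists of the points of \<open>A\<close> whose link has odd Euler
  characteristic. The closure only changes it in dimension less than \<open>k - 1\<close>; it is needed when
  \<open>A\<close> is not of pure dimension.\<close>

definition sa_boundary_set :: "('p, 's) rscheme \<Rightarrow> 'p set \<Rightarrow> 'p set" where
  "sa_boundary_set X A = euclid X closure_of
     {x \<in> A. \<exists>U S. affine_open X U \<and> x \<in> U \<and> alg_generators X U S \<and>
        (\<exists>\<delta>>0. \<forall>\<epsilon>. 0 < \<epsilon> \<and> \<epsilon> < \<delta> \<longrightarrow>
           odd (euler_char (subtopology (euclid X) (sphere_link X U S x \<epsilon> A))))}"

definition sa_boundary :: "('p, 's) rscheme \<Rightarrow> int \<Rightarrow> 'p set set set \<Rightarrow> 'p set set set" where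
  "sa_boundary X k = chain_map_of X k (k - 1) (sa_boundary_set X)"

definition sa_action ::
    "('p, 's) rscheme \<Rightarrow> ('g \<Rightarrow> ('p, 's, 'p, 's) mor) \<Rightarrow> int \<Rightarrow> 'g \<Rightarrow> 'p set set set \<Rightarrow> 'p set set set" where
  "sa_action X \<rho> k g = chain_map_of X k k (\<lambda>A. pmap (\<rho> g) ` A)"

section \<open>The Nash-constructible filtration\<close>

definition nash_constructible_complete :: "std_rscheme \<Rightarrow> (real \<Rightarrow> int) \<Rightarrow> bool" where
  "nash_constructible_complete Y \<psi> \<longleftrightarrow>
     (\<exists>(n::nat) (m::nat \<Rightarrow> int) (Z::nat \<Rightarrow> std_rscheme) f Z'.
        (\<forall>i<n. real_variety (Z i) \<and> proper_mor (Z i) Y (f i) \<and>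
           Z' i \<in> connected_components_of (euclid (Z i))) \<and>
        (\<forall>x\<in>real_pts Y. \<psi> x = (\<Sum>i<n. m i *
           euler_char (subtopology (euclid (Z i)) {z \<in> Z' i. pmap (f i) z = x}))))"

definition nash_constructible :: "('p, 's) rscheme \<Rightarrow> ('p \<Rightarrow> int) \<Rightarrow> bool" where
  "nash_constructible X \<phi> \<longleftrightarrow> (\<exists>(Y::std_rscheme) j \<psi>. complete_variety Y \<and>
     open_immersion X Y j \<and> zar Y closure_of (pmap j ` pts X) = pts Y \<and>
     nash_constructible_complete Y \<psi> \<and> (\<forall>x\<in>real_pts X. \<phi> x = \<psi> (pmap j x)))"

text \<open>For \<open>p = 0\<close> the description in the last case again yields all \<open>k\<close>-chains.\<close>

definition nash_filtration :: "('p, 's) rscheme \<Rightarrow> int \<Rightarrow> int \<Rightarrow> 'p set set set set" where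
  "nash_filtration X p k =
     (if p \<ge> 0 then carrier (sa_chains X k)
      else if p < - k then {\<one>\<^bsub>sa_chains X k\<^esub>}
      else {c \<in> carrier (sa_chains X k). \<exists>\<phi> \<psi> S A.
        (\<forall>x\<in>real_pts X. 2 ^ nat (k + p) dvd \<phi> x) \<and>
        nash_constructible X \<psi> \<and> small X k S \<and> (\<forall>x\<in>real_pts X - S. \<phi> x = \<psi> x) \<and>
        A \<in> chain_gens X k \<and> c = chain_class X k A \<and>
        (\<exists>S'. small X k S' \<and>
           sym_diff A {x \<in> real_pts X. \<not> 2 ^ nat (k + p + 1) dvd \<phi> x} \<subseteq> S')})"

section \<open>Complexes with action and their total complexes\<close>

text \<open>Abelian groups are written multiplicatively, as in the homology library; a
  \<open>\<int>[G]\<close>-module is an abelian group with an action of \<open>G\<close> by homomorphisms.\<close>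

definition G_module :: "('g, 'm) monoid_scheme \<Rightarrow> 'f monoid \<Rightarrow> ('g \<Rightarrow> 'f \<Rightarrow> 'f) \<Rightarrow> bool" where
  "G_module G M a \<longleftrightarrow> comm_group M \<and> (\<forall>g\<in>carrier G. a g \<in> hom M M) \<and>
     (\<forall>x\<in>carrier M. a \<one>\<^bsub>G\<^esub> x = x) \<and>
     (\<forall>g\<in>carrier G. \<forall>h\<in>carrier G. \<forall>x\<in>carrier M. a (g \<otimes>\<^bsub>G\<^esub> h) x = a g (a h x))"

definition G_hom ::
    "('g, 'm) monoid_scheme \<Rightarrow> 'f monoid \<Rightarrow> ('g \<Rightarrow> 'f \<Rightarrow> 'f) \<Rightarrow> 'k monoid \<Rightarrow> ('g \<Rightarrow> 'k \<Rightarrow> 'k) \<Rightarrow> ('f \<Rightarrow> 'k) set" where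
  "G_hom G M a N b = {u \<in> hom M N \<inter> extensional (carrier M).
     \<forall>g\<in>carrier G. \<forall>x\<in>carrier M. u (a g x) = b g (u x)}"

definition Hom_group ::
    "('g, 'm) monoid_scheme \<Rightarrow> 'f monoid \<Rightarrow> ('g \<Rightarrow> 'f \<Rightarrow> 'f) \<Rightarrow> 'k monoid \<Rightarrow> ('g \<Rightarrow> 'k \<Rightarrow> 'k) \<Rightarrow> ('f \<Rightarrow> 'k) monoid" where
  "Hom_group G M a N b = \<lparr>carrier = G_hom G M a N b,
     monoid.mult = (\<lambda>u v. \<lambda>x\<in>carrier M. u x \<otimes>\<^bsub>N\<^esub> v x), one = (\<lambda>x\<in>carrier M. \<one>\<^bsub>N\<^esub>)\<rparr>"

text \<open>Lifting property of \<open>P\<close> along surjections \<open>\<pi>\<close> from \<open>M\<close> to \<open>N\<close>. The type of \<open>N\<close> contains \<open>P\<close> and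
  that of \<open>M\<close> contains the free \<open>\<int>[G]\<close>-module on \<open>P\<close>, so lifting in these types makes \<open>P\<close> a direct
  summand of a free module, hence projective without restriction.\<close>

definition projective_G_module ::
    "('g, 'm) monoid_scheme \<Rightarrow> 'f monoid \<Rightarrow> ('g \<Rightarrow> 'f \<Rightarrow> 'f) \<Rightarrow> bool" where
  "projective_G_module G P a \<longleftrightarrow> G_module G P a \<and>
     (\<forall>(M::('g \<times> 'f \<Rightarrow> int) monoid) b (N::'f monoid) c \<pi> u.
        G_module G M b \<and> G_module G N c \<and> \<pi> \<in> G_hom G M b N c \<and> \<pi> ` carrier M = carrier N \<and>
        u \<in> G_hom G P a N c \<longrightarrow>
        (\<exists>v\<in>G_hom G P a M b. \<forall>x\<in>carrier P. \<pi> (v x) = u x))"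

text \<open>\<open>rdiff n\<close> goes from degree \<open>Suc n\<close> to degree \<open>n\<close>.\<close>

record ('g, 'f) G_resolution =
  rgrp :: "nat \<Rightarrow> 'f monoid"
  ract :: "nat \<Rightarrow> 'g \<Rightarrow> 'f \<Rightarrow> 'f"
  rdiff :: "nat \<Rightarrow> 'f \<Rightarrow> 'f"
  raug :: "'f \<Rightarrow> int"

definition projective_resolution ::
    "('g, 'm) monoid_scheme \<Rightarrow> ('g, 'f) G_resolution \<Rightarrow> bool" where
  "projective_resolution G F \<longleftrightarrow>
     (\<forall>n. projective_G_module G (rgrp F n) (ract F n)) \<and>
     (\<forall>n. rdiff F n \<in> G_hom G (rgrp F (Suc n)) (ract F (Suc n)) (rgrp F n) (ract F n)) \<and>
     raug F \<in> G_hom G (rgrp F 0) (ract F 0) integer_group (\<lambda>g. id) \<and>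
     raug F ` carrier (rgrp F 0) = UNIV \<and>
     rdiff F 0 ` carrier (rgrp F 1) = kernel (rgrp F 0) integer_group (raug F) \<and>
     (\<forall>n. rdiff F (Suc n) ` carrier (rgrp F (Suc (Suc n))) =
        kernel (rgrp F (Suc n)) (rgrp F n) (rdiff F n))"

text \<open>\<open>cdiff k\<close> goes from degree \<open>k\<close> to degree \<open>k - 1\<close>.\<close>

record ('g, 'k) G_complex =
  cgrp :: "int \<Rightarrow> 'k monoid"
  cdiff :: "int \<Rightarrow> 'k \<Rightarrow> 'k"
  cact :: "int \<Rightarrow> 'g \<Rightarrow> 'k \<Rightarrow> 'k"

text \<open>The total complex of \<open>Hom\<^sub>G(F\<^sub>-\<^sub>p, K\<^sub>q)\<close>, with \<open>n = - p \<ge> 0\<close> and so \<open>q = k + n\<close> in degree \<open>k\<close>. As \<open>K\<close>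
  consists of \<open>\<int>\<^sub>2\<close>-vector spaces there are no signs in the differential.\<close>

definition L_group ::
    "('g, 'm) monoid_scheme \<Rightarrow> ('g, 'f) G_resolution \<Rightarrow> ('g, 'k) G_complex \<Rightarrow> int \<Rightarrow> (nat \<Rightarrow> 'f \<Rightarrow> 'k) monoid" where
  "L_group G F K k =
     (let H = (\<lambda>n. Hom_group G (rgrp F n) (ract F n) (cgrp K (k + int n)) (cact K (k + int n)))
      in \<lparr>carrier = {u. (\<forall>n. u n \<in> carrier (H n)) \<and> finite {n. u n \<noteq> \<one>\<^bsub>H n\<^esub>}},
          monoid.mult = (\<lambda>u v n. u n \<otimes>\<^bsub>H n\<^esub> v n), one = (\<lambda>n. \<one>\<^bsub>H n\<^esub>)\<rparr>)"

definition L_diff ::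
    "('g, 'f) G_resolution \<Rightarrow> ('g, 'k) G_complex \<Rightarrow> int \<Rightarrow> (nat \<Rightarrow> 'f \<Rightarrow> 'k) \<Rightarrow> nat \<Rightarrow> 'f \<Rightarrow> 'k" where
  "L_diff F K k u n = (\<lambda>x\<in>carrier (rgrp F n).
     cdiff K (k + int n) (u n x) \<otimes>\<^bsub>cgrp K (k + int n - 1)\<^esub>
     (case n of 0 \<Rightarrow> \<one>\<^bsub>cgrp K (k + int n - 1)\<^esub> | Suc m \<Rightarrow> u m (rdiff F m x)))"

definition subcomplex :: "('g, 'k) G_complex \<Rightarrow> (int \<Rightarrow> 'k set) \<Rightarrow> ('g, 'k) G_complex" where
  "subcomplex K J = K\<lparr>cgrp := (\<lambda>q. (cgrp K q)\<lparr>carrier := J q\<rparr>)\<rparr>"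

definition L_filtration ::
    "('g, 'm) monoid_scheme \<Rightarrow> ('g, 'f) G_resolution \<Rightarrow> ('g, 'k) G_complex \<Rightarrow> (int \<Rightarrow> int \<Rightarrow> 'k set) \<Rightarrow>
     int \<Rightarrow> int \<Rightarrow> (nat \<Rightarrow> 'f \<Rightarrow> 'k) set" where
  "L_filtration G F K J \<alpha> k = carrier (L_group G F (subcomplex K (J \<alpha>)) k)"

section \<open>Spectral sequences\<close>

text \<open>The term \<open>E\<^sup>r\<^sub>p\<^sub>,\<^sub>q\<close> of the complex \<open>(C, D)\<close> with the increasing filtration \<open>J\<close>, in degree \<open>k = p + q\<close>:
  \<open>(J\<^sub>p \<inter> D\<inverse>(J\<^sub>p\<^sub>-\<^sub>r) + J\<^sub>p\<^sub>-\<^sub>1) / (J\<^sub>p \<inter> D(J\<^sub>p\<^sub>+\<^sub>r\<^sub>-\<^sub>1) + J\<^sub>p\<^sub>-\<^sub>1)\<close>.\<close>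

definition spectral_term ::
    "(int \<Rightarrow> 'l monoid) \<Rightarrow> (int \<Rightarrow> 'l \<Rightarrow> 'l) \<Rightarrow> (int \<Rightarrow> int \<Rightarrow> 'l set) \<Rightarrow>
     int \<Rightarrow> int \<Rightarrow> int \<Rightarrow> 'l set monoid" where
  "spectral_term C D J r p q =
     (let k = p + q;
          Z = generate (C k) ({x \<in> J p k. D k x \<in> J (p - r) (k - 1)} \<union> J (p - 1) k);
          B = generate (C k) ((J p k \<inter> D (k + 1) ` J (p + r - 1) (k + 1)) \<union> J (p - 1) k)
      in (C k)\<lparr>carrier := Z\<rparr> Mod B)"

definition weight_complex ::
    "('p, 's) rscheme \<Rightarrow> ('g \<Rightarrow> ('p, 's, 'p, 's) mor) \<Rightarrow> ('g, 'p set set set) G_complex" where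
  "weight_complex X \<rho> = \<lparr>cgrp = sa_chains X, cdiff = sa_boundary X, cact = sa_action X \<rho>\<rparr>"

definition equivariant_E ::
    "('g, 'm) monoid_scheme \<Rightarrow> ('g, 'f) G_resolution \<Rightarrow> ('p, 's) rscheme \<Rightarrow> ('g \<Rightarrow> ('p, 's, 'p, 's) mor) \<Rightarrow>
     int \<Rightarrow> int \<Rightarrow> int \<Rightarrow> (nat \<Rightarrow> 'f \<Rightarrow> 'p set set set) set monoid" where
  "equivariant_E G F X \<rho> = spectral_term
     (L_group G F (weight_complex X \<rho>))
     (L_diff F (weight_complex X \<rho>))
     (L_filtration G F (weight_complex X \<rho>) (nash_filtration X))"

text \<open>The reindexing \<open>p' = 2 p + q\<close>, \<open>q' = - p\<close>, \<open>r' = r + 1\<close>, solved for \<open>p\<close>, \<open>q\<close>, \<open>r\<close>.\<close>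

definition equivariant_weight_E ::
    "('g, 'm) monoid_scheme \<Rightarrow> ('g, 'f) G_resolution \<Rightarrow> ('p, 's) rscheme \<Rightarrow> ('g \<Rightarrow> ('p, 's, 'p, 's) mor) \<Rightarrow>
     int \<Rightarrow> int \<Rightarrow> int \<Rightarrow> (nat \<Rightarrow> 'f \<Rightarrow> 'p set set set) set monoid" where
  "equivariant_weight_E G F X \<rho> r' p' q' = equivariant_E G F X \<rho> (r' - 1) (- q') (p' + 2 * q')"

end

theory Submission
  imports Defs
begin

text \<open>The terms with index \<open>\<alpha> = - q\<close> and total degree \<open>k = p + q\<close> are computed from
  \<open>\<J>\<^sub>\<alpha> L\<^sub>k\<close> and \<open>\<J>\<^sub>\<alpha>\<^sub>-\<^sub>1 L\<^sub>k\<close>. For \<open>\<alpha> > 0\<close> these coincide. There are no nonzero chains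
  of dimension above \<open>d\<close>, and \<open>L\<^sub>k\<close> involves only chains of dimension at least \<open>k\<close>, so \<open>L\<^sub>k = 0\<close>
  for \<open>k > d\<close>. Finally \<open>\<N>\<^sub>\<alpha> C\<^sub>m = 0\<close> for \<open>m < - \<alpha>\<close>, hence for every \<open>m\<close> if \<open>\<alpha> < - d\<close>.\<close>

section \<open>Dimension\<close>

lemma irreducible_closed_subtopology:
  assumes "closedin T S" and "irreducible_closed (subtopology T S) Z"
  shows "irreducible_closed T Z"
proof -
  have cl: "closedin (subtopology T S) A \<longleftrightarrow> closedin T A \<and> A \<subseteq> S" for A
    using closedin_closed_subtopology[OF assms(1)] .
  show ?thesis
    using assms(2) unfolding irreducible_closed_def cl by blast
qed

lemma krull_dim_closed_subspace:
  assumes "closedin T S"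
  shows "krull_dim (subtopology T S) \<le> krull_dim T"
  unfolding krull_dim_def
  by (rule Sup_subset_mono) (use irreducible_closed_subtopology[OF assms] in blast)

lemma semialg_dim_le: "semialg_dim X A \<le> krull_dim (zar X)"
  unfolding semialg_dim_def by (rule krull_dim_closed_subspace) simp

section \<open>Chain groups\<close>

lemma sym_diff_assoc: "sym_diff (sym_diff a b) c = sym_diff a (sym_diff b c)"
  by blast

lemma sym_diff_cancel: "sym_diff (sym_diff a b) b = a"
  by blast

lemma chain_rels_empty: "{} \<in> chain_rels X k"
  using generate.one[of "free_Z2 (chain_gens X k)"] by (simp add: chain_rels_def free_Z2_def)

lemma chain_rels_sym_diff:
  assumes "E \<in> chain_rels X k" and "F \<in> chain_rels X k"
  shows "sym_diff E F \<in> chain_rels X k"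
  using generate.eng[of E "free_Z2 (chain_gens X k)" _ F] assms
  by (simp add: chain_rels_def free_Z2_def)

text \<open>The right coset of \<open>a\<close>, written as an image so that products reduce to
  identities between sets; coset lemmas for subgroups would require the relations to be sums of
  generators.\<close>

definition rel_coset :: "('p, 's) rscheme \<Rightarrow> int \<Rightarrow> 'p set set \<Rightarrow> 'p set set set" where
  "rel_coset X k a = (\<lambda>e. sym_diff e a) ` chain_rels X k"

lemma rel_coset_empty: "rel_coset X k {} = chain_rels X k"
  by (simp add: rel_coset_def)

text \<open>The set of all finite sums of generators and relations is closed under symmetric difference
  whether or not the relations are sums of generators. So the closures which occur in the
  relations need not be known to be semialgebraic.\<close>

lemma rel_coset_mult:
  "rel_coset X k a <#>\<^bsub>free_Z2 (chain_gens X k)\<^esub> rel_coset X k b = rel_coset X k (sym_diff a b)"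
proof -
  have *: "sym_diff (sym_diff e a) (sym_diff f b) = sym_diff (sym_diff e f) (sym_diff a b)"
    for e f by blast
  have "rel_coset X k a <#>\<^bsub>free_Z2 (chain_gens X k)\<^esub> rel_coset X k b
      = (\<Union>e\<in>chain_rels X k. \<Union>f\<in>chain_rels X k. {sym_diff (sym_diff e a) (sym_diff f b)})"
    by (simp add: set_mult_def rel_coset_def free_Z2_def)
  also have "\<dots> = rel_coset X k (sym_diff a b)"
    unfolding * rel_coset_def
  proof (intro equalityI UN_least image_subsetI)
    fix e f assume "e \<in> chain_rels X k" "f \<in> chain_rels X k"
    then have "sym_diff e f \<in> chain_rels X k" by (rule chain_rels_sym_diff)
    then show "{sym_diff (sym_diff e f) (sym_diff a b)}
        \<subseteq> (\<lambda>e. sym_diff e (sym_diff a b)) ` chain_rels X k"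
      by simp
  next
    fix e assume "e \<in> chain_rels X k"
    moreover have "sym_diff e (sym_diff a b) \<in> {sym_diff (sym_diff e {}) (sym_diff a b)}" by simp
    ultimately show "sym_diff e (sym_diff a b) \<in>
        (\<Union>e\<in>chain_rels X k. \<Union>f\<in>chain_rels X k. {sym_diff (sym_diff e f) (sym_diff a b)})"
      using chain_rels_empty by (intro UN_I)
  qed
  finally show ?thesis .
qed

lemma carrier_sa_chains:
  "carrier (sa_chains X k) = rel_coset X k ` {a. finite a \<and> a \<subseteq> chain_gens X k}"
  unfolding sa_chains_def FactGroup_def RCOSETS_def r_coset_def rel_coset_def
  by (auto simp: free_Z2_def)

lemma one_sa_chains: "\<one>\<^bsub>sa_chains X k\<^esub> = rel_coset X k {}"
  by (simp add: sa_chains_def FactGroup_def rel_coset_empty)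

lemma mult_sa_chains:
  "rel_coset X k a \<otimes>\<^bsub>sa_chains X k\<^esub> rel_coset X k b = rel_coset X k (sym_diff a b)"
  by (simp add: sa_chains_def FactGroup_def rel_coset_mult)

lemma sa_chains_cases:
  assumes "c \<in> carrier (sa_chains X k)"
  obtains a where "finite a" "a \<subseteq> chain_gens X k" "c = rel_coset X k a"
  using assms unfolding carrier_sa_chains by blast

text \<open>Addition is symmetric difference, so every chain is its own inverse. All inverses below
  come from this.\<close>

lemma sa_chains_square:
  assumes "c \<in> carrier (sa_chains X k)"
  shows "c \<otimes>\<^bsub>sa_chains X k\<^esub> c = \<one>\<^bsub>sa_chains X k\<^esub>"
  using assms by (rule sa_chains_cases) (simp only: one_sa_chains mult_sa_chains Diff_cancel Un_empty_left)

lemma group_sa_chains: "group (sa_chains X k)"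
proof (rule groupI)
  fix x y assume "x \<in> carrier (sa_chains X k)" "y \<in> carrier (sa_chains X k)"
  then obtain a b where ab: "finite a" "a \<subseteq> chain_gens X k" "finite b" "b \<subseteq> chain_gens X k"
      "x = rel_coset X k a" "y = rel_coset X k b"
    by (metis sa_chains_cases)
  then have "sym_diff a b \<in> {a. finite a \<and> a \<subseteq> chain_gens X k}" by auto
  then show "x \<otimes>\<^bsub>sa_chains X k\<^esub> y \<in> carrier (sa_chains X k)"
    by (simp only: ab mult_sa_chains carrier_sa_chains) (rule imageI)
next
  show "\<one>\<^bsub>sa_chains X k\<^esub> \<in> carrier (sa_chains X k)"
    unfolding one_sa_chains carrier_sa_chains by (rule imageI) simp
next
  fix x y z assume "x \<in> carrier (sa_chains X k)" "y \<in> carrier (sa_chains X k)"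
    "z \<in> carrier (sa_chains X k)"
  then obtain a b c where abc: "x = rel_coset X k a" "y = rel_coset X k b" "z = rel_coset X k c"
    by (metis sa_chains_cases)
  show "x \<otimes>\<^bsub>sa_chains X k\<^esub> y \<otimes>\<^bsub>sa_chains X k\<^esub> z
      = x \<otimes>\<^bsub>sa_chains X k\<^esub> (y \<otimes>\<^bsub>sa_chains X k\<^esub> z)"
    by (simp only: abc mult_sa_chains sym_diff_assoc)
next
  fix x assume x: "x \<in> carrier (sa_chains X k)"
  then obtain a where a: "x = rel_coset X k a"
    by (metis sa_chains_cases)
  show "\<one>\<^bsub>sa_chains X k\<^esub> \<otimes>\<^bsub>sa_chains X k\<^esub> x = x"
    by (simp only: a one_sa_chains mult_sa_chains) simp
  show "\<exists>y\<in>carrier (sa_chains X k). y \<otimes>\<^bsub>sa_chains X k\<^esub> x = \<one>\<^bsub>sa_chains X k\<^esub>"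
    using x sa_chains_square[OF x] by blast
qed

text \<open>A generator has at most the dimension of \<open>X\<close>, hence less than
  \<open>k\<close>, and is itself a relation. So is every formal sum of generators, and its coset is
  trivial.\<close>

lemma sa_chains_above_dim:
  assumes "krull_dim (zar X) < ereal (of_int k)"
  shows "carrier (sa_chains X k) = {\<one>\<^bsub>sa_chains X k\<^esub>}"
proof -
  have gen: "{A} \<in> chain_rels X k" if "A \<in> chain_gens X k" for A
  proof -
    have "semialg_dim X A < ereal (of_int k)"
      using semialg_dim_le[of X A] assms by (rule le_less_trans)
    then show ?thesis
      unfolding chain_rels_def using that by (intro generate.incl UnI2) blast
  qed
  have rel: "a \<in> chain_rels X k" if "finite a" "a \<subseteq> chain_gens X k" for a
    using that
  proof (induction a)
    case (insert A a)
    then have "sym_diff a {A} \<in> chain_rels X k"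
      by (intro chain_rels_sym_diff gen) auto
    moreover have "sym_diff a {A} = insert A a" using insert.hyps by blast
    ultimately show ?case by simp
  qed (rule chain_rels_empty)
  have "rel_coset X k a = rel_coset X k {}" if "a \<in> chain_rels X k" for a
  proof -
    \<comment> \<open>Adding \<open>a\<close> twice gives back \<open>e\<close>, and
      \<open>e\<close> plus \<open>a\<close> is again a relation.\<close>
    have "e \<in> rel_coset X k a" if "e \<in> chain_rels X k" for e
      unfolding rel_coset_def
      by (rule image_eqI[where x = "sym_diff e a"], rule sym_diff_cancel[symmetric],
          rule chain_rels_sym_diff[OF that \<open>a \<in> chain_rels X k\<close>])
    moreover have "rel_coset X k a \<subseteq> chain_rels X k"
      unfolding rel_coset_def by (rule image_subsetI) (rule chain_rels_sym_diff[OF _ that])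
    ultimately show ?thesis
      unfolding rel_coset_empty by blast
  qed
  with rel have "rel_coset X k ` {a. finite a \<and> a \<subseteq> chain_gens X k} \<subseteq> {rel_coset X k {}}"
    by (intro image_subsetI) (simp only: mem_Collect_eq singleton_iff)
  moreover have "rel_coset X k {} \<in> rel_coset X k ` {a. finite a \<and> a \<subseteq> chain_gens X k}"
    by (rule imageI) simp
  ultimately show ?thesis
    unfolding carrier_sa_chains one_sa_chains by blast
qed

section \<open>The two ends of the Nash-constructible filtration\<close>

lemma nash_filtration_nonneg: "0 \<le> p \<Longrightarrow> nash_filtration X p k = carrier (sa_chains X k)"
  by (simp add: nash_filtration_def)

lemma nash_filtration_subset: "nash_filtration X p k \<subseteq> carrier (sa_chains X k)"
  using monoid.one_closed[OF group.is_monoid[OF group_sa_chains], of X k]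
  by (auto simp: nash_filtration_def)

text \<open>Degrees \<open>k < - p\<close> vanish by definition, as \<open>p < 0\<close> excludes
  its first case; all other degrees exceed the dimension.\<close>

lemma nash_filtration_trivial:
  assumes "krull_dim (zar X) < ereal (of_int (- p))" and "p < 0"
  shows "nash_filtration X p k \<subseteq> {\<one>\<^bsub>sa_chains X k\<^esub>}"
proof (cases "p < - k")
  case True
  with assms(2) show ?thesis by (simp add: nash_filtration_def)
next
  case False
  then have "ereal (of_int (- p)) \<le> ereal (of_int k)" by simp
  with assms(1) have "krull_dim (zar X) < ereal (of_int k)" by (rule less_le_trans)
  then show ?thesis
    by (rule subset_trans[OF nash_filtration_subset equalityD1[OF sa_chains_above_dim]])
qed

section \<open>Total complexes\<close>

text \<open>The families in \<open>L_group\<close> freed from additivity, equivariance and finite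
  support, so that pointwise operations preserve them.\<close>

definition cochains :: "('g, 'f) G_resolution \<Rightarrow> ('g, 'k) G_complex \<Rightarrow> int \<Rightarrow> (nat \<Rightarrow> 'f \<Rightarrow> 'k) set" where
  "cochains F K k = {u. \<forall>n. u n \<in> carrier (rgrp F n) \<rightarrow>\<^sub>E carrier (cgrp K (k + int n))}"

lemma one_L_group:
  "\<one>\<^bsub>L_group G F K k\<^esub> = (\<lambda>n. \<lambda>x\<in>carrier (rgrp F n). \<one>\<^bsub>cgrp K (k + int n)\<^esub>)"
  by (simp add: L_group_def Hom_group_def Let_def)

lemma mult_L_group:
  "u \<otimes>\<^bsub>L_group G F K k\<^esub> v =
     (\<lambda>n. \<lambda>x\<in>carrier (rgrp F n). u n x \<otimes>\<^bsub>cgrp K (k + int n)\<^esub> v n x)"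
  by (simp add: L_group_def Hom_group_def Let_def)

lemma carrier_L_group_subset: "carrier (L_group G F K k) \<subseteq> cochains F K k"
  unfolding L_group_def Hom_group_def Let_def cochains_def G_hom_def hom_def PiE_def by simp blast

lemma L_group_subcomplex:
  assumes "\<And>q. J q \<subseteq> carrier (cgrp K q)"
  shows "carrier (L_group G F (subcomplex K J) k) \<subseteq> carrier (L_group G F K k)"
proof -
  have "G_hom G M a ((cgrp K q)\<lparr>carrier := J q\<rparr>) b \<subseteq> G_hom G M a (cgrp K q) b" for M a b q
    unfolding G_hom_def hom_def using assms by (auto intro!: subsetD[OF assms])
  then show ?thesis
    unfolding L_group_def Hom_group_def Let_def subcomplex_def by simp blast
qed

text \<open>Off the carrier both families are \<open>undefined\<close>, so comparing values on it
  suffices. Equality would also require the unit family to be equivariant.\<close>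

lemma L_group_subcomplex_trivial:
  assumes "\<And>n::nat. J (k + int n) \<subseteq> {\<one>\<^bsub>cgrp K (k + int n)\<^esub>}"
  shows "carrier (L_group G F (subcomplex K J) k) \<subseteq> {\<one>\<^bsub>L_group G F K k\<^esub>}"
proof
  fix u assume u: "u \<in> carrier (L_group G F (subcomplex K J) k)"
  have "u n x = \<one>\<^bsub>L_group G F K k\<^esub> n x" for n x
  proof -
    have un: "u n \<in> carrier (rgrp F n) \<rightarrow>\<^sub>E J (k + int n)"
      using subsetD[OF carrier_L_group_subset u] by (simp add: cochains_def subcomplex_def)
    show ?thesis
    proof (cases "x \<in> carrier (rgrp F n)")
      case True
      with PiE_mem[OF un] assms show ?thesis by (auto simp: one_L_group)
    next
      case False
      with PiE_arb[OF un] show ?thesis by (simp add: one_L_group)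
    qed
  qed
  then show "u \<in> {\<one>\<^bsub>L_group G F K k\<^esub>}" by auto
qed

text \<open>Only the chain groups are constrained; differential and action stay arbitrary.\<close>

locale Z2_complex =
  fixes K :: "('g, 'k) G_complex"
  assumes group_cgrp: "group (cgrp K q)"
    and square_cgrp: "c \<in> carrier (cgrp K q) \<Longrightarrow> c \<otimes>\<^bsub>cgrp K q\<^esub> c = \<one>\<^bsub>cgrp K q\<^esub>"
begin

lemma square_cochain:
  "u \<in> cochains F K k \<Longrightarrow> u \<otimes>\<^bsub>L_group G F K k\<^esub> u = \<one>\<^bsub>L_group G F K k\<^esub>"
  by (auto simp: cochains_def mult_L_group one_L_group PiE_iff fun_eq_iff restrict_def square_cgrp)

text \<open>The equivariant cochains are not known to be closed under multiplication, since the action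
  on chains need not be additive. All cochains form a group in any case.\<close>

lemma group_cochains: "group ((L_group G F K k)\<lparr>carrier := cochains F K k\<rparr>)"
proof (rule groupI, goal_cases)
  case (1 u v)
  then show ?case
    by (auto simp: cochains_def mult_L_group PiE_iff intro!: monoid.m_closed group.is_monoid group_cgrp)
next
  case 2
  show ?case
    by (auto simp: cochains_def one_L_group intro!: monoid.one_closed group.is_monoid group_cgrp)
next
  case (3 u v w)
  then show ?case
    by (auto simp: cochains_def mult_L_group PiE_iff fun_eq_iff restrict_def
        intro!: monoid.m_assoc group.is_monoid group_cgrp)
next
  case (4 u)
  then show ?case
    by (auto simp: cochains_def mult_L_group one_L_group PiE_iff fun_eq_iff restrict_def
        extensional_def intro!: monoid.l_one group.is_monoid group_cgrp)
next
  case (5 u)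
  then have "u \<otimes>\<^bsub>L_group G F K k\<^esub> u = \<one>\<^bsub>L_group G F K k\<^esub>"
    by (simp add: square_cochain)
  with 5 show ?case by auto
qed

text \<open>The inverse is a definite description over a carrier not known to form a group. The
  square gives existence, cancellation among all cochains gives uniqueness.\<close>

lemma inv_L_group:
  assumes "u \<in> carrier (L_group G F K k)"
  shows "inv\<^bsub>L_group G F K k\<^esub> u = u"
proof -
  let ?P = "(L_group G F K k)\<lparr>carrier := cochains F K k\<rparr>"
  interpret P: group ?P by (rule group_cochains)
  have u: "u \<in> cochains F K k" using assms carrier_L_group_subset by blast
  note sq = square_cochain[OF u, of G]
  have "v = u" if "v \<in> carrier (L_group G F K k)" "v \<otimes>\<^bsub>L_group G F K k\<^esub> u = \<one>\<^bsub>L_group G F K k\<^esub>" for v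
    using P.right_cancel[of u v u] u that sq subsetD[OF carrier_L_group_subset that(1)] by simp
  then show ?thesis
    unfolding m_inv_def using assms sq by (intro the_equality) auto
qed

text \<open>Products may leave the carrier of \<open>L_group\<close> but remain cochains, where
  every element is its own inverse.\<close>

lemma subgroup_generate_L_group:
  assumes "S \<subseteq> carrier (L_group G F K k)"
  shows "subgroup (generate (L_group G F K k) S) ((L_group G F K k)\<lparr>carrier := cochains F K k\<rparr>)"
proof -
  let ?P = "(L_group G F K k)\<lparr>carrier := cochains F K k\<rparr>"
  interpret P: group ?P by (rule group_cochains)
  have sub: "u \<in> cochains F K k" if "u \<in> generate (L_group G F K k) S" for u
    using that
  proof induction
    case one
    show ?case using P.one_closed by simp
  next
    case (incl h)
    then show ?case using assms carrier_L_group_subset by blast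
  next
    case (inv h)
    then have "h \<in> carrier (L_group G F K k)" using assms by blast
    then show ?case using inv_L_group carrier_L_group_subset by fastforce
  next
    case (eng h1 h2)
    then show ?case using P.m_closed by simp
  qed
  show ?thesis
  proof (rule P.subgroupI)
    fix u assume u: "u \<in> generate (L_group G F K k) S"
    have "inv\<^bsub>?P\<^esub> u = u"
      using P.inv_equality[of u u] sub[OF u] square_cochain[OF sub[OF u], of G] by simp
    with u show "inv\<^bsub>?P\<^esub> u \<in> generate (L_group G F K k) S" by simp
  qed (use sub generate.one in \<open>auto intro: generate.eng\<close>)
qed

text \<open>Cosets depend on the multiplication only, so they can be computed in the group of all
  cochains, where translating \<open>Z\<close> by its own element gives \<open>Z\<close>.\<close>

lemma generate_L_group_quotient:
  fixes G :: "('g, 'm) monoid_scheme"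
  assumes "S \<subseteq> carrier (L_group G F K k)"
  defines "Z \<equiv> generate (L_group G F K k) S"
  shows "carrier ((L_group G F K k)\<lparr>carrier := Z\<rparr> Mod Z) = {Z}"
proof -
  let ?P = "(L_group G F K k)\<lparr>carrier := cochains F K k\<rparr>"
  interpret P: group ?P by (rule group_cochains)
  have Z: "subgroup Z ?P"
    unfolding Z_def by (rule subgroup_generate_L_group[OF assms(1)])
  have "Z #>\<^bsub>L_group G F K k\<^esub> a = Z" if "a \<in> Z" for a
    using P.coset_join2[OF subgroup.mem_carrier[OF Z that] Z that] by (simp add: r_coset_def)
  then show ?thesis
    using subgroup.one_closed[OF Z] by (auto simp: FactGroup_def RCOSETS_def r_coset_def)
qed

end

text \<open>\<open>S\<close> is empty or consists of the unit, which \<open>generate\<close> adds in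
  any case.\<close>

lemma generate_L_group_trivial:
  assumes "Z2_complex K"
    and "S \<subseteq> carrier (L_group G F K k)" and "S \<subseteq> {\<one>\<^bsub>L_group G F K k\<^esub>}"
  shows "generate (L_group G F K k) S = generate (L_group G F K k) {}"
proof (cases "S = {}")
  case False
  interpret Z2_complex K by fact
  let ?P = "(L_group G F K k)\<lparr>carrier := cochains F K k\<rparr>"
  interpret P: group ?P by (rule group_cochains)
  have S: "S = {\<one>\<^bsub>L_group G F K k\<^esub>}" using False assms(3) by blast
  have "u \<in> generate (L_group G F K k) {}" if "u \<in> generate (L_group G F K k) S" for u
    using that
  proof induction
    case (inv h)
    then show ?case using inv_L_group[of h G F k] assms(2) S generate.one by fastforce
  qed (use S in \<open>auto intro: generate.intros\<close>)
  moreover have "u \<in> generate (L_group G F K k) S" if "u \<in> generate (L_group G F K k) {}" for u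
    using that by induction (auto intro: generate.intros)
  ultimately show ?thesis by blast
qed simp

section \<open>The spectral sequence\<close>

lemma Z2_complex_weight_complex: "Z2_complex (weight_complex X \<rho>)"
  by (rule Z2_complex.intro) (simp_all add: weight_complex_def group_sa_chains sa_chains_square)

lemma L_filtration_subset:
  "L_filtration G F (weight_complex X \<rho>) (nash_filtration X) \<alpha> k
     \<subseteq> carrier (L_group G F (weight_complex X \<rho>) k)"
  unfolding L_filtration_def
  by (rule L_group_subcomplex) (simp add: weight_complex_def nash_filtration_subset)

lemma L_filtration_trivial:
  assumes "krull_dim (zar X) < ereal (of_int k) \<or>
    \<alpha> < 0 \<and> krull_dim (zar X) < ereal (of_int (- \<alpha>))"
  shows "L_filtration G F (weight_complex X \<rho>) (nash_filtration X) \<alpha> k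
     \<subseteq> {\<one>\<^bsub>L_group G F (weight_complex X \<rho>) k\<^esub>}"
  unfolding L_filtration_def
proof (rule L_group_subcomplex_trivial)
  fix n :: nat
  have "nash_filtration X \<alpha> (k + int n) \<subseteq> {\<one>\<^bsub>sa_chains X (k + int n)\<^esub>}"
    using assms
  proof
    assume "krull_dim (zar X) < ereal (of_int k)"
    moreover have "ereal (of_int k) \<le> ereal (of_int (k + int n))" by simp
    ultimately have "krull_dim (zar X) < ereal (of_int (k + int n))" by (rule less_le_trans)
    then show ?thesis
      by (rule subset_trans[OF nash_filtration_subset equalityD1[OF sa_chains_above_dim]])
  next
    assume "\<alpha> < 0 \<and> krull_dim (zar X) < ereal (of_int (- \<alpha>))"
    then show ?thesis by (intro nash_filtration_trivial) simp_all
  qed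
  then show "nash_filtration X \<alpha> (k + int n) \<subseteq> {\<one>\<^bsub>cgrp (weight_complex X \<rho>) (k + int n)\<^esub>}"
    by (simp add: weight_complex_def)
qed

text \<open>It suffices that the generators \<open>?SZ\<close> of the numerator and
  \<open>?SB\<close> of the denominator generate the same set: the term is then a subgroup modulo
  itself.\<close>

lemma equivariant_E_trivial:
  assumes "\<alpha> > 0 \<or> krull_dim (zar X) < ereal (of_int (\<alpha> + \<beta>)) \<or>
    \<alpha> < 0 \<and> krull_dim (zar X) < ereal (of_int (- \<alpha>))"
  shows "carrier (equivariant_E G F X \<rho> r \<alpha> \<beta>) = {\<one>\<^bsub>equivariant_E G F X \<rho> r \<alpha> \<beta>\<^esub>}"
proof -
  let ?W = "weight_complex X \<rho>"
  let ?k = "\<alpha> + \<beta>"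
  let ?L = "L_group G F ?W ?k"
  let ?J = "\<lambda>\<alpha>. L_filtration G F ?W (nash_filtration X) \<alpha> ?k"
  let ?SZ = "{x \<in> ?J \<alpha>. L_diff F ?W ?k x \<in> L_filtration G F ?W (nash_filtration X) (\<alpha> - r) (?k - 1)}
    \<union> ?J (\<alpha> - 1)"
  let ?SB = "(?J \<alpha> \<inter> L_diff F ?W (?k + 1) `
    L_filtration G F ?W (nash_filtration X) (\<alpha> + r - 1) (?k + 1)) \<union> ?J (\<alpha> - 1)"
  interpret Z2_complex ?W by (rule Z2_complex_weight_complex)
  have sub: "?SZ \<subseteq> carrier ?L" "?SB \<subseteq> carrier ?L"
    using L_filtration_subset by blast+
  have eq: "generate ?L ?SZ = generate ?L ?SB"
  proof (cases "\<alpha> > 0")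
    case True
    then have "nash_filtration X \<alpha> = nash_filtration X (\<alpha> - 1)"
      by (simp add: nash_filtration_nonneg fun_eq_iff)
    then have "?J \<alpha> = ?J (\<alpha> - 1)" by (simp add: L_filtration_def)
    \<comment> \<open>Each set is the union of a part of \<open>?J \<alpha>\<close> and all of
      \<open>?J (\<alpha> - 1)\<close>.\<close>
    then have "?SZ = ?J (\<alpha> - 1)" "?SB = ?J (\<alpha> - 1)" by blast+
    then show ?thesis by simp
  next
    case False
    \<comment> \<open>Level \<open>\<alpha> - 1\<close> occurs in both sets and must vanish too; the
      bound for \<open>\<alpha>\<close> passes down to it.\<close>
    have "ereal (of_int (- \<alpha>)) \<le> ereal (of_int (- (\<alpha> - 1)))" by simp
    then have *: "krull_dim (zar X) < ereal (of_int (- (\<alpha> - 1)))"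
      if "krull_dim (zar X) < ereal (of_int (- \<alpha>))"
      using that by (rule less_le_trans[rotated])
    have \<alpha>: "krull_dim (zar X) < ereal (of_int ?k) \<or>
        \<alpha> < 0 \<and> krull_dim (zar X) < ereal (of_int (- \<alpha>))"
      using False assms by blast
    then have "krull_dim (zar X) < ereal (of_int ?k) \<or>
        \<alpha> - 1 < 0 \<and> krull_dim (zar X) < ereal (of_int (- (\<alpha> - 1)))"
    proof (elim disjE conjE)
      assume "\<alpha> < 0" and "krull_dim (zar X) < ereal (of_int (- \<alpha>))"
      from this(1) *[OF this(2)] show ?thesis by (intro disjI2 conjI) simp_all
    qed (rule disjI1)
    from L_filtration_trivial[OF \<alpha>] L_filtration_trivial[OF this]
    have "?J \<alpha> \<subseteq> {\<one>\<^bsub>?L\<^esub>}" "?J (\<alpha> - 1) \<subseteq> {\<one>\<^bsub>?L\<^esub>}" .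
    then have "?SZ \<subseteq> {\<one>\<^bsub>?L\<^esub>}" "?SB \<subseteq> {\<one>\<^bsub>?L\<^esub>}" by blast+
    then show ?thesis
      using generate_L_group_trivial[OF Z2_complex_weight_complex sub(1)]
        generate_L_group_trivial[OF Z2_complex_weight_complex sub(2)] by simp
  qed
  have "equivariant_E G F X \<rho> r \<alpha> \<beta> = ?L\<lparr>carrier := generate ?L ?SZ\<rparr> Mod generate ?L ?SB"
    by (simp add: equivariant_E_def spectral_term_def Let_def)
  then have E: "equivariant_E G F X \<rho> r \<alpha> \<beta> = ?L\<lparr>carrier := generate ?L ?SZ\<rparr> Mod generate ?L ?SZ"
    by (simp only: eq)
  show ?thesis
    unfolding E generate_L_group_quotient[OF sub(1)] by (simp add: FactGroup_def)
qed

theorem corollary3p20: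
  fixes G :: "('g, 'm) monoid_scheme"
    and F :: "('g, 'f) G_resolution"
    and X :: "('p, 's) rscheme"
    and \<rho> :: "'g \<Rightarrow> ('p, 's, 'p, 's) mor"
    and d :: nat
    and r p q :: int
  assumes "group G" and "finite (carrier G)"
    and "projective_resolution G F"
    and "real_G_variety G X \<rho>"
    and "krull_dim (zar X) = ereal (real d)"
    and "r \<ge> 2"
    and "carrier (equivariant_weight_E G F X \<rho> r p q) \<noteq> {\<one>\<^bsub>equivariant_weight_E G F X \<rho> r p q\<^esub>}"
  shows "0 \<le> q \<and> q \<le> int d \<and> p + q \<le> int d"
proof -
  \<comment> \<open>With \<alpha> = \<open>- q\<close> and \<beta> = \<open>p + 2 * q\<close> the
    total degree is \<open>p + q\<close>. The last alternative gives \<open>q \<le> d\<close> when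
    \<open>q > 0\<close>; for \<open>q = 0\<close> this holds because \<open>d\<close> is
    natural.\<close>
  have "\<not> (- q > 0 \<or> krull_dim (zar X) < ereal (of_int (- q + (p + 2 * q))) \<or>
      - q < 0 \<and> krull_dim (zar X) < ereal (of_int (- (- q))))"
    using equivariant_E_trivial assms(7) unfolding equivariant_weight_E_def by blast
  then show ?thesis
    unfolding assms(5) by auto
qed

end
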